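(* Let $\phi$ be a flow of a compact metric space $X$. (1) If $\Omega(\phi)\setminus Sing(\phi)$ is closed, then $h^*(\phi)=h(\phi)$. (2) If $\phi$ is singular-equicontinuous, then $h^*(\phi)=0$.
   Context: A flow is a continuous $\phi:\mathbb{R}\times X\to X$ with $\phi_0=\mathrm{id}$, $\phi_{t+s}=\phi_t\circ\phi_s$; $Sing(\phi)$ is the set of fixed points; $dist(z,A)=\inf_{a\in A}d(z,a)$. $x$ is nonwandering if $U\cap\bigcup_{t\ge T}\phi_t(U)\ne\emptyset$ for every $T>0$ and every neighborhood $U$ of $x$; $\Omega(\phi)$ is the set of nonwandering points. For compact $K\subset X$, $t>0$, $\epsilon>0$, let $r(t,\epsilon)$ be the minimal cardinality of $F\subset K$ with $K\subset\bigcup_{x\in F}\{y\in X: d(\phi_s(x),\phi_s(y))\le\epsilon\ \forall 0\le s\le t\}$, and $h(\phi,K)=\lim_{\epsilon\to0}\limsup_{t\to\infty}\frac1t\ln r(t,\epsilon)$; $h(\phi)=h(\phi,X)$ and $h^*(\phi)=\sup\{h(\phi,K): K\subset X\setminus Sing(\phi)\text{ compact}\}$. $\phi$ is singular-equicontinuous if for every $\epsilon>0$ there is $\delta>0$ such that $x,y\in X$ and $d(x,y)\le\delta\,dist(x,Sing(\phi))$ imply $d(\phi_t(x),\phi_t(y))\le\epsilon$ for all $t\in\mathbb{R}$. *)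

theory Defs
  imports "HOL-Analysis.Analysis"
begin

definition is_flow :: "(real \<Rightarrow> 'a::metric_space \<Rightarrow> 'a) \<Rightarrow> bool" where
  "is_flow \<phi> \<longleftrightarrow> continuous_on UNIV (\<lambda>p. \<phi> (fst p) (snd p)) \<and>
     \<phi> 0 = id \<and> (\<forall>t s. \<phi> (t + s) = \<phi> t \<circ> \<phi> s)"

definition Sing :: "(real \<Rightarrow> 'a \<Rightarrow> 'a) \<Rightarrow> 'a set" where
  "Sing \<phi> = {x. \<forall>t. \<phi> t x = x}"

definition dist_set :: "'a::metric_space \<Rightarrow> 'a set \<Rightarrow> ereal" where
  "dist_set z A = (if A = {} then \<infinity> else ereal (infdist z A))"

definition nonwandering :: "(real \<Rightarrow> 'a::topological_space \<Rightarrow> 'a) \<Rightarrow> 'a set" where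
  "nonwandering \<phi> = {x. \<forall>U T. open U \<and> x \<in> U \<and> T > 0 \<longrightarrow>
      U \<inter> (\<Union>t\<in>{T..}. \<phi> t ` U) \<noteq> {}}"

definition dyn_ball :: "(real \<Rightarrow> 'a::metric_space \<Rightarrow> 'a) \<Rightarrow> real \<Rightarrow> real \<Rightarrow> 'a \<Rightarrow> 'a set" where
  "dyn_ball \<phi> t \<epsilon> x = {y. \<forall>s\<in>{0..t}. dist (\<phi> s x) (\<phi> s y) \<le> \<epsilon>}"

definition span_num :: "(real \<Rightarrow> 'a::metric_space \<Rightarrow> 'a) \<Rightarrow> 'a set \<Rightarrow> real \<Rightarrow> real \<Rightarrow> nat" where
  "span_num \<phi> K t \<epsilon> = (LEAST n. \<exists>F. F \<subseteq> K \<and> finite F \<and> card F = n \<and>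
      K \<subseteq> (\<Union>x\<in>F. dyn_ball \<phi> t \<epsilon> x))"

definition entropy_on :: "(real \<Rightarrow> 'a::metric_space \<Rightarrow> 'a) \<Rightarrow> 'a set \<Rightarrow> ereal" where
  "entropy_on \<phi> K = Lim (at_right 0)
     (\<lambda>\<epsilon>. Limsup at_top (\<lambda>t. ereal (ln (real (span_num \<phi> K t \<epsilon>)) / t)))"

definition entropy :: "(real \<Rightarrow> 'a::metric_space \<Rightarrow> 'a) \<Rightarrow> ereal" where
  "entropy \<phi> = entropy_on \<phi> UNIV"

definition entropy_star :: "(real \<Rightarrow> 'a::metric_space \<Rightarrow> 'a) \<Rightarrow> ereal" where
  "entropy_star \<phi> = (SUP K\<in>{K. compact K \<and> K \<subseteq> - Sing \<phi>}. entropy_on \<phi> K)"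

definition singular_equicontinuous :: "(real \<Rightarrow> 'a::metric_space \<Rightarrow> 'a) \<Rightarrow> bool" where
  "singular_equicontinuous \<phi> \<longleftrightarrow> (\<forall>\<epsilon>>0. \<exists>\<delta>>0. \<forall>x y.
      ereal (dist x y) \<le> ereal \<delta> * dist_set x (Sing \<phi>) \<longrightarrow>
      (\<forall>t. dist (\<phi> t x) (\<phi> t y) \<le> \<epsilon>))"

end

theory Submission
  imports Defs "HOL-Real_Asymp.Real_Asymp"
begin

text \<open>The entropy of a flow on a compact space is carried by its nonwandering set (Bowen): cut
  orbits into pieces of length \<open>\<tau>\<close>; pieces starting near the nonwandering set are coded by a minimal
  spanning set of it, the others start in a compact set of wandering points, which is visited
  boundedly often and so contributes only a polynomial factor. On the other hand the entropy of a
  union is the maximum of the entropies, and a flow that is equicontinuous on a compact set has no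
  entropy there. The singularities are fixed, so removing them from the nonwandering set does not
  change its entropy. Singular equicontinuity makes the flow equicontinuous on every compact set
  away from the singularities.\<close>

section \<open>Spanning sets and entropy\<close>

definition spans :: "(real \<Rightarrow> 'a::metric_space \<Rightarrow> 'a) \<Rightarrow> 'a set \<Rightarrow> real \<Rightarrow> real \<Rightarrow> 'a set \<Rightarrow> bool" where
  "spans \<phi> K t \<epsilon> F \<longleftrightarrow> finite F \<and> K \<subseteq> (\<Union>x\<in>F. dyn_ball \<phi> t \<epsilon> x)"

definition growth_rate :: "(real \<Rightarrow> 'a::metric_space \<Rightarrow> 'a) \<Rightarrow> 'a set \<Rightarrow> real \<Rightarrow> ereal" where
  "growth_rate \<phi> K \<epsilon> = Limsup at_top (\<lambda>t. ereal (ln (real (span_num \<phi> K t \<epsilon>)) / t))"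

lemma dyn_ball_mono_radius: "\<epsilon> \<le> \<epsilon>' \<Longrightarrow> dyn_ball \<phi> t \<epsilon> x \<subseteq> dyn_ball \<phi> t \<epsilon>' x"
  unfolding dyn_ball_def by (auto intro: order_trans)

lemma dyn_ball_commute: "y \<in> dyn_ball \<phi> t \<epsilon> x \<longleftrightarrow> x \<in> dyn_ball \<phi> t \<epsilon> y"
  by (simp add: dyn_ball_def dist_commute)

lemma dyn_ball_triangle:
  assumes "y \<in> dyn_ball \<phi> t \<epsilon> x" "z \<in> dyn_ball \<phi> t \<epsilon>' y"
  shows "z \<in> dyn_ball \<phi> t (\<epsilon> + \<epsilon>') x"
proof -
  have "dist (\<phi> s x) (\<phi> s z) \<le> \<epsilon> + \<epsilon>'" if "s \<in> {0..t}" for s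
  proof -
    have "dist (\<phi> s x) (\<phi> s z) \<le> dist (\<phi> s x) (\<phi> s y) + dist (\<phi> s y) (\<phi> s z)"
      by (rule dist_triangle)
    also have "\<dots> \<le> \<epsilon> + \<epsilon>'"
      using assms that by (intro add_mono) (auto simp: dyn_ball_def)
    finally show ?thesis .
  qed
  then show ?thesis by (simp add: dyn_ball_def)
qed

lemma dyn_ball_common_centre:
  assumes "y \<in> dyn_ball \<phi> t \<epsilon> x" "z \<in> dyn_ball \<phi> t \<epsilon> x"
  shows "z \<in> dyn_ball \<phi> t (2 * \<epsilon>) y"
  using dyn_ball_triangle[OF dyn_ball_commute[THEN iffD1, OF assms(1)] assms(2)] by simp

lemma spans_nhd_twice_radius:
  assumes "spans \<phi> K t \<epsilon> F" "z \<in> (\<Union>y\<in>K. interior (dyn_ball \<phi> t \<epsilon> y))"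
  shows "\<exists>x\<in>F. z \<in> dyn_ball \<phi> t (2 * \<epsilon>) x"
proof -
  obtain y where y: "y \<in> K" "z \<in> dyn_ball \<phi> t \<epsilon> y"
    using assms(2) subsetD[OF interior_subset] by blast
  then obtain x where x: "x \<in> F" "y \<in> dyn_ball \<phi> t \<epsilon> x"
    using assms(1) by (auto simp: spans_def)
  show ?thesis
    using x(1) dyn_ball_triangle[OF x(2) y(2)] by auto
qed

lemma centre_in_interior_dyn_ball:
  assumes "is_flow \<phi>" "\<epsilon> > 0"
  shows "x \<in> interior (dyn_ball \<phi> t \<epsilon> x)"
proof -
  let ?W = "{p. dist (\<phi> (snd p) x) (\<phi> (snd p) (fst p)) < \<epsilon>}"
  have flow_cont: "continuous_on UNIV (\<lambda>p. \<phi> (fst p) (snd p))"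
    using assms(1) by (simp add: is_flow_def)
  have "continuous_on UNIV (\<lambda>p. \<phi> (snd p) (fst p))" "continuous_on UNIV (\<lambda>p. \<phi> (snd p) x)"
    by (rule continuous_on_compose2[OF flow_cont, of _ "\<lambda>p. (snd p, fst p)", simplified]
        continuous_on_compose2[OF flow_cont, of _ "\<lambda>p. (snd p, x)", simplified];
        intro continuous_intros)+
  then have "open ?W"
    by (intro open_Collect_less continuous_intros)
  moreover have "{x} \<times> {0..t} \<subseteq> ?W"
    using assms(2) by auto
  ultimately obtain U where U: "open U" "x \<in> U" "U \<times> {0..t} \<subseteq> ?W"
    using Elementary_Topology.tube_lemma[OF compact_Icc, of ?W x 0 t] by blast
  from U(3) have "U \<subseteq> dyn_ball \<phi> t \<epsilon> x"
    by (force simp: dyn_ball_def)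
  with U(1,2) show ?thesis
    by (rule interiorI)
qed

lemma compact_finite_subcover_nhds:
  assumes "compact K"
    and nhd: "\<And>x. x \<in> K \<Longrightarrow> \<exists>U. open U \<and> x \<in> U \<and> K \<inter> U \<subseteq> D x"
  obtains F where "finite F" "F \<subseteq> K" "K \<subseteq> (\<Union>x\<in>F. D x)"
proof -
  obtain U where U: "\<And>x. x \<in> K \<Longrightarrow> open (U x) \<and> x \<in> U x \<and> K \<inter> U x \<subseteq> D x"
    using nhd by metis
  then have "K \<subseteq> (\<Union>x\<in>K. U x)" by blast
  then obtain F where F: "F \<subseteq> K" "finite F" "K \<subseteq> (\<Union>x\<in>F. U x)"
    using compactE_image[OF assms(1), of K U] U by metis
  have "K \<subseteq> (\<Union>x\<in>F. D x)"
  proof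
    fix y assume "y \<in> K"
    then obtain x where "x \<in> F" "y \<in> K \<inter> U x"
      using F(3) by blast
    then show "y \<in> (\<Union>x\<in>F. D x)"
      using U F(1) by blast
  qed
  with F(1,2) show thesis
    using that by blast
qed

lemma ex_spanning_set:
  assumes "is_flow \<phi>" "\<epsilon> > 0" "compact K"
  obtains F where "spans \<phi> K t \<epsilon> F" "F \<subseteq> K"
proof -
  have "\<exists>U. open U \<and> x \<in> U \<and> K \<inter> U \<subseteq> dyn_ball \<phi> t \<epsilon> x" for x
    using centre_in_interior_dyn_ball[OF assms(1,2), of x t] unfolding interior_def by blast
  then obtain F where "finite F" "F \<subseteq> K" "K \<subseteq> (\<Union>x\<in>F. dyn_ball \<phi> t \<epsilon> x)"
    by (rule compact_finite_subcover_nhds[OF assms(3)])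
  then show thesis
    using that by (simp add: spans_def)
qed

lemma span_num_le_card:
  assumes "spans \<phi> K t \<epsilon> F" "F \<subseteq> K"
  shows "span_num \<phi> K t \<epsilon> \<le> card F"
  unfolding span_num_def using assms by (intro Least_le) (auto simp: spans_def)

lemma ex_minimal_spanning_set:
  assumes "is_flow \<phi>" "\<epsilon> > 0" "compact K"
  obtains F where "spans \<phi> K t \<epsilon> F" "F \<subseteq> K" "card F = span_num \<phi> K t \<epsilon>"
proof -
  have "\<exists>n F. F \<subseteq> K \<and> finite F \<and> card F = n \<and> K \<subseteq> (\<Union>x\<in>F. dyn_ball \<phi> t \<epsilon> x)"
    using ex_spanning_set[OF assms] unfolding spans_def by metis
  from LeastI_ex[OF this] show thesis
    using that unfolding span_num_def spans_def by metis
qed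

lemma span_num_pos:
  assumes "is_flow \<phi>" "\<epsilon> > 0" "compact K" "K \<noteq> {}"
  shows "span_num \<phi> K t \<epsilon> > 0"
proof -
  obtain F where F: "spans \<phi> K t \<epsilon> F" "card F = span_num \<phi> K t \<epsilon>"
    using ex_minimal_spanning_set[OF assms(1-3)] by metis
  then have "finite F" "F \<noteq> {}"
    using assms(4) by (auto simp: spans_def)
  then show ?thesis
    using F(2) card_gt_0_iff by metis
qed

lemma span_num_le_card_coding:
  assumes "finite S" "code ` K \<subseteq> S"
    and close: "\<And>x y. x \<in> K \<Longrightarrow> y \<in> K \<Longrightarrow> code x = code y \<Longrightarrow> y \<in> dyn_ball \<phi> t \<epsilon> x"
  shows "span_num \<phi> K t \<epsilon> \<le> card S"
proof -
  let ?F = "inv_into K code ` code ` K"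
  have fin: "finite (code ` K)"
    using assms finite_subset by blast
  have "y \<in> dyn_ball \<phi> t \<epsilon> (inv_into K code (code y))" if "y \<in> K" for y
    using that by (intro close) (auto intro: inv_into_into f_inv_into_f)
  then have "spans \<phi> K t \<epsilon> ?F"
    using fin unfolding spans_def by blast
  moreover have "?F \<subseteq> K"
    by (auto intro: inv_into_into)
  ultimately have "span_num \<phi> K t \<epsilon> \<le> card ?F"
    by (rule span_num_le_card)
  also have "\<dots> \<le> card (code ` K)"
    using fin by (rule card_image_le)
  also have "\<dots> \<le> card S"
    using assms by (intro card_mono)
  finally show ?thesis .
qed

text \<open>The factor of two is the price for centres outside \<open>K\<close>, which \<^const>\<open>span_num\<close> does not admit.\<close>

lemma span_num_le_card_external:
  assumes "spans \<phi> K t \<epsilon> F"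
  shows "span_num \<phi> K t (2 * \<epsilon>) \<le> card F"
proof -
  have "\<exists>x\<in>F. y \<in> dyn_ball \<phi> t \<epsilon> x" if "y \<in> K" for y
    using assms that by (auto simp: spans_def)
  then obtain centre where "\<And>y. y \<in> K \<Longrightarrow> centre y \<in> F \<and> y \<in> dyn_ball \<phi> t \<epsilon> (centre y)"
    by metis
  then show ?thesis
    using assms by (intro span_num_le_card_coding[where code = centre])
      (auto simp: spans_def, metis dyn_ball_common_centre)
qed

lemma ln_of_nat_mono: "m \<le> n \<Longrightarrow> ln (real m) \<le> ln (real n)"
  by (cases "m = 0"; cases "n = 0") auto

lemma growth_rate_le_Limsup:
  assumes "\<And>t. t > 0 \<Longrightarrow> ln (real (span_num \<phi> K t \<epsilon>)) / t \<le> f t"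
  shows "growth_rate \<phi> K \<epsilon> \<le> Limsup at_top (\<lambda>t. ereal (f t))"
  unfolding growth_rate_def using assms
  by (intro Limsup_mono eventually_mono[OF eventually_gt_at_top[of 0]]) simp

lemma growth_rate_le_if_span_num_le:
  assumes "\<And>t. span_num \<phi> K t \<epsilon> \<le> span_num \<phi> L t \<epsilon>'"
  shows "growth_rate \<phi> K \<epsilon> \<le> growth_rate \<phi> L \<epsilon>'"
  unfolding growth_rate_def[of \<phi> L]
  by (rule growth_rate_le_Limsup) (simp add: divide_right_mono ln_of_nat_mono assms)

lemma growth_rate_antimono:
  assumes "is_flow \<phi>" "compact K" "0 < \<epsilon>" "\<epsilon> \<le> \<epsilon>'"
  shows "growth_rate \<phi> K \<epsilon>' \<le> growth_rate \<phi> K \<epsilon>"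
proof (rule growth_rate_le_if_span_num_le)
  fix t
  obtain F where F: "spans \<phi> K t \<epsilon> F" "F \<subseteq> K" "card F = span_num \<phi> K t \<epsilon>"
    using ex_minimal_spanning_set[OF assms(1,3,2)] by metis
  have "spans \<phi> K t \<epsilon>' F"
    using F(1) dyn_ball_mono_radius[OF assms(4)] unfolding spans_def by blast
  then show "span_num \<phi> K t \<epsilon>' \<le> span_num \<phi> K t \<epsilon>"
    using span_num_le_card F(2,3) by metis
qed

text \<open>This includes \<open>K = {}\<close>, as \<open>ln 0 = 0\<close>.\<close>

lemma growth_rate_nonneg: "growth_rate \<phi> K \<epsilon> \<ge> 0"
proof -
  have "0 \<le> ln (real n)" for n
    using ln_of_nat_mono[of 0 n] by simp
  then show ?thesis
    unfolding growth_rate_def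
    by (intro le_Limsup eventually_mono[OF eventually_gt_at_top[of 0]]) auto
qed

lemma entropy_on_eq_SUP:
  assumes "is_flow \<phi>" "compact K"
  shows "entropy_on \<phi> K = (SUP \<epsilon>\<in>{0<..}. growth_rate \<phi> K \<epsilon>)"
proof -
  have "(growth_rate \<phi> K \<longlongrightarrow> (SUP \<epsilon>\<in>{0<..}. growth_rate \<phi> K \<epsilon>)) (at_right 0)"
  proof (rule order_tendstoI)
    fix a assume "a < (SUP \<epsilon>\<in>{0<..}. growth_rate \<phi> K \<epsilon>)"
    then obtain \<epsilon> where \<epsilon>: "\<epsilon> > 0" "a < growth_rate \<phi> K \<epsilon>"
      by (auto simp: less_SUP_iff)
    have "a < growth_rate \<phi> K \<epsilon>'" if "\<epsilon>' > 0" "\<epsilon>' < \<epsilon>" for \<epsilon>'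
      using growth_rate_antimono[OF assms, of \<epsilon>' \<epsilon>] that \<epsilon>(2) by auto
    then show "\<forall>\<^sub>F \<epsilon>' in at_right 0. a < growth_rate \<phi> K \<epsilon>'"
      using \<epsilon>(1) unfolding eventually_at_right_field by blast
  next
    fix a assume "(SUP \<epsilon>\<in>{0<..}. growth_rate \<phi> K \<epsilon>) < a"
    then have "growth_rate \<phi> K \<epsilon> < a" if "\<epsilon> > 0" for \<epsilon>
      using that SUP_upper[of \<epsilon> "{0<..}" "growth_rate \<phi> K"] by auto
    then show "\<forall>\<^sub>F \<epsilon> in at_right 0. growth_rate \<phi> K \<epsilon> < a"
      unfolding eventually_at_right_field using zero_less_one by blast
  qed
  then show ?thesis
    unfolding entropy_on_def growth_rate_def by (intro tendsto_Lim) auto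
qed

lemma growth_rate_le_entropy_on:
  assumes "is_flow \<phi>" "compact K" "\<epsilon> > 0"
  shows "growth_rate \<phi> K \<epsilon> \<le> entropy_on \<phi> K"
  unfolding entropy_on_eq_SUP[OF assms(1,2)] using assms(3) by (intro SUP_upper) simp

lemma entropy_on_leI:
  assumes "is_flow \<phi>" "compact K" "c > 0" "\<And>\<epsilon>. \<epsilon> > 0 \<Longrightarrow> growth_rate \<phi> K (c * \<epsilon>) \<le> h"
  shows "entropy_on \<phi> K \<le> h"
  unfolding entropy_on_eq_SUP[OF assms(1,2)]
proof (rule SUP_least)
  fix \<epsilon> :: real assume "\<epsilon> \<in> {0<..}"
  then show "growth_rate \<phi> K \<epsilon> \<le> h"
    using assms(4)[of "\<epsilon> / c"] \<open>c > 0\<close> by simp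
qed

lemma entropy_on_nonneg:
  assumes "is_flow \<phi>" "compact K"
  shows "entropy_on \<phi> K \<ge> 0"
  using growth_rate_nonneg growth_rate_le_entropy_on[OF assms zero_less_one] by (rule order_trans)

lemma entropy_on_mono:
  assumes "is_flow \<phi>" "compact K" "compact L" "K \<subseteq> L"
  shows "entropy_on \<phi> K \<le> entropy_on \<phi> L"
proof (rule entropy_on_leI[OF assms(1,2), of 2])
  fix \<epsilon> :: real assume "\<epsilon> > 0"
  have "span_num \<phi> K t (2 * \<epsilon>) \<le> span_num \<phi> L t \<epsilon>" for t
  proof -
    obtain F where F: "spans \<phi> L t \<epsilon> F" "card F = span_num \<phi> L t \<epsilon>"
      using ex_minimal_spanning_set[OF assms(1) \<open>\<epsilon> > 0\<close> assms(3)] by metis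
    then have "spans \<phi> K t \<epsilon> F"
      using assms(4) by (auto simp: spans_def)
    then show ?thesis
      using span_num_le_card_external F(2) by metis
  qed
  then have "growth_rate \<phi> K (2 * \<epsilon>) \<le> growth_rate \<phi> L \<epsilon>"
    by (rule growth_rate_le_if_span_num_le)
  also have "\<dots> \<le> entropy_on \<phi> L"
    using assms(1,3) \<open>\<epsilon> > 0\<close> by (rule growth_rate_le_entropy_on)
  finally show "growth_rate \<phi> K (2 * \<epsilon>) \<le> entropy_on \<phi> L" .
qed simp

lemma entropy_star_le_entropy:
  fixes \<phi> :: "real \<Rightarrow> 'a::metric_space \<Rightarrow> 'a"
  assumes "compact (UNIV :: 'a set)" "is_flow \<phi>"
  shows "entropy_star \<phi> \<le> entropy \<phi>"
  unfolding entropy_star_def entropy_def by (intro SUP_least entropy_on_mono assms) auto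

section \<open>The entropy of a union\<close>

lemma Limsup_max_le:
  fixes f g :: "'a \<Rightarrow> 'b::complete_linorder"
  shows "Limsup F (\<lambda>x. max (f x) (g x)) \<le> max (Limsup F f) (Limsup F g)"
  unfolding Limsup_le_iff by (auto intro: eventually_conj dest: Limsup_lessD)

lemma Limsup_add_tendsto_zero_le:
  fixes f g :: "'a \<Rightarrow> real"
  assumes "(g \<longlongrightarrow> 0) F" "F \<noteq> bot"
  shows "Limsup F (\<lambda>x. ereal (f x + g x)) \<le> Limsup F (\<lambda>x. ereal (f x))"
proof (rule ereal_le_epsilon2)
  fix e :: real assume "e > 0"
  then have "\<forall>\<^sub>F x in F. g x < e"
    using assms(1) by (auto dest: order_tendstoD)
  then have "Limsup F (\<lambda>x. ereal (f x + g x)) \<le> Limsup F (\<lambda>x. ereal (f x) + ereal e)"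
    by (intro Limsup_mono) (auto elim!: eventually_mono)
  also have "\<dots> = Limsup F (\<lambda>x. ereal (f x)) + ereal e"
    using assms(2) by (intro Limsup_add_ereal_right) auto
  finally show "Limsup F (\<lambda>x. ereal (f x + g x)) \<le> Limsup F (\<lambda>x. ereal (f x)) + ereal e" .
qed

lemma span_num_Un_le:
  assumes "is_flow \<phi>" "compact K" "compact L" "\<epsilon> > 0"
  shows "span_num \<phi> (K \<union> L) t (2 * \<epsilon>) \<le> span_num \<phi> K t \<epsilon> + span_num \<phi> L t \<epsilon>"
proof -
  obtain F G where F: "spans \<phi> K t \<epsilon> F" "card F = span_num \<phi> K t \<epsilon>"
    and G: "spans \<phi> L t \<epsilon> G" "card G = span_num \<phi> L t \<epsilon>"
    using ex_minimal_spanning_set[OF assms(1,4)] assms(2,3) by metis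
  have "spans \<phi> (K \<union> L) t \<epsilon> (F \<union> G)"
    using F(1) G(1) by (auto simp: spans_def)
  then have "span_num \<phi> (K \<union> L) t (2 * \<epsilon>) \<le> card (F \<union> G)"
    by (rule span_num_le_card_external)
  also have "\<dots> \<le> card F + card G"
    by (rule card_Un_le)
  finally show ?thesis
    by (simp add: F(2) G(2))
qed

lemma ln_add_le_ln_max:
  "ln (real (m + n)) \<le> max (ln (real m)) (ln (real n)) + ln 2"
proof (cases "m + n = 0")
  case False
  have "ln (real (m + n)) \<le> ln (real (max m n * 2))"
    by (rule ln_of_nat_mono) simp
  also have "\<dots> = ln (real (max m n)) + ln 2"
    using False by (subst of_nat_mult, subst ln_mult) auto
  also have "ln (real (max m n)) \<le> max (ln (real m)) (ln (real n))"
    by (simp add: max_def)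
  finally show ?thesis by simp
qed simp

lemma growth_rate_Un_le:
  assumes "is_flow \<phi>" "compact K" "compact L" "\<epsilon> > 0"
  shows "growth_rate \<phi> (K \<union> L) (2 * \<epsilon>) \<le> max (growth_rate \<phi> K \<epsilon>) (growth_rate \<phi> L \<epsilon>)"
proof -
  define rate where "rate A t = ln (real (span_num \<phi> A t \<epsilon>)) / t" for A t
  have "ln (real (span_num \<phi> (K \<union> L) t (2 * \<epsilon>))) / t \<le> max (rate K t) (rate L t) + ln 2 / t"
    if "t > 0" for t
  proof -
    have "ln (real (span_num \<phi> (K \<union> L) t (2 * \<epsilon>))) / t
        \<le> ln (real (span_num \<phi> K t \<epsilon> + span_num \<phi> L t \<epsilon>)) / t"
      using that by (intro divide_right_mono ln_of_nat_mono span_num_Un_le assms) simp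
    also have "\<dots> \<le> (max (ln (real (span_num \<phi> K t \<epsilon>))) (ln (real (span_num \<phi> L t \<epsilon>))) + ln 2) / t"
      using that by (intro divide_right_mono ln_add_le_ln_max) simp
    also have "\<dots> = max (rate K t) (rate L t) + ln 2 / t"
      using that by (simp add: rate_def add_divide_distrib max_divide_distrib_right)
    finally show ?thesis .
  qed
  then have "growth_rate \<phi> (K \<union> L) (2 * \<epsilon>)
      \<le> Limsup at_top (\<lambda>t. ereal (max (rate K t) (rate L t) + ln 2 / t))"
    by (rule growth_rate_le_Limsup)
  also have "\<dots> \<le> Limsup at_top (\<lambda>t. max (ereal (rate K t)) (ereal (rate L t)))"
    unfolding ereal_max[symmetric] by (rule Limsup_add_tendsto_zero_le) (real_asymp, simp)
  also have "\<dots> \<le> max (growth_rate \<phi> K \<epsilon>) (growth_rate \<phi> L \<epsilon>)"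
    unfolding growth_rate_def rate_def by (rule Limsup_max_le)
  finally show ?thesis .
qed

lemma entropy_on_Un:
  assumes "is_flow \<phi>" "compact K" "compact L"
  shows "entropy_on \<phi> (K \<union> L) = max (entropy_on \<phi> K) (entropy_on \<phi> L)"
proof (rule antisym)
  have "growth_rate \<phi> (K \<union> L) (2 * \<epsilon>) \<le> max (entropy_on \<phi> K) (entropy_on \<phi> L)" if "\<epsilon> > 0" for \<epsilon>
    using growth_rate_Un_le[OF assms that] growth_rate_le_entropy_on[OF assms(1) _ that] assms(2,3)
    by (meson max.mono order_trans)
  then show "entropy_on \<phi> (K \<union> L) \<le> max (entropy_on \<phi> K) (entropy_on \<phi> L)"
    using assms by (intro entropy_on_leI[where c = 2]) auto
  show "max (entropy_on \<phi> K) (entropy_on \<phi> L) \<le> entropy_on \<phi> (K \<union> L)"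
    using assms by (intro max.boundedI entropy_on_mono) auto
qed

section \<open>Equicontinuity\<close>

definition forward_equicontinuous_on :: "(real \<Rightarrow> 'a::metric_space \<Rightarrow> 'a) \<Rightarrow> 'a set \<Rightarrow> bool" where
  "forward_equicontinuous_on \<phi> S \<longleftrightarrow> (\<forall>x\<in>S. \<forall>\<epsilon>>0. \<exists>\<delta>>0. \<forall>y\<in>S. dist x y < \<delta> \<longrightarrow>
      (\<forall>t\<ge>0. dist (\<phi> t x) (\<phi> t y) \<le> \<epsilon>))"

lemma entropy_on_forward_equicontinuous:
  assumes "is_flow \<phi>" "compact K" "forward_equicontinuous_on \<phi> K"
  shows "entropy_on \<phi> K = 0"
proof (rule antisym[OF entropy_on_leI[OF assms(1,2) zero_less_one] entropy_on_nonneg[OF assms(1,2)]])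
  fix \<epsilon> :: real assume "\<epsilon> > 0"
  let ?D = "\<lambda>x. {y. \<forall>t\<ge>0. dist (\<phi> t x) (\<phi> t y) \<le> \<epsilon>}"
  have "\<exists>U. open U \<and> x \<in> U \<and> K \<inter> U \<subseteq> ?D x" if x: "x \<in> K" for x
  proof -
    obtain \<delta> where "\<delta> > 0"
      "\<And>y. y \<in> K \<Longrightarrow> dist x y < \<delta> \<Longrightarrow> \<forall>t\<ge>0. dist (\<phi> t x) (\<phi> t y) \<le> \<epsilon>"
      using assms(3) x \<open>\<epsilon> > 0\<close> unfolding forward_equicontinuous_on_def by metis
    then show ?thesis
      by (intro exI[of _ "ball x \<delta>"]) auto
  qed
  then obtain F where F: "finite F" "F \<subseteq> K" "K \<subseteq> (\<Union>x\<in>F. ?D x)"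
    by (rule compact_finite_subcover_nhds[OF assms(2)])
  have "(\<Union>x\<in>F. ?D x) \<subseteq> (\<Union>x\<in>F. dyn_ball \<phi> t \<epsilon> x)" for t
    by (rule UN_mono) (auto simp: dyn_ball_def)
  with F have "span_num \<phi> K t \<epsilon> \<le> card F" for t
    by (intro span_num_le_card) (simp_all add: spans_def subset_trans)
  then have "growth_rate \<phi> K (1 * \<epsilon>) \<le> Limsup at_top (\<lambda>t. ereal (ln (real (card F)) / t))"
    by (intro growth_rate_le_Limsup) (simp add: divide_right_mono ln_of_nat_mono)
  also have "\<dots> = 0"
  proof -
    have "((\<lambda>t. ln (real (card F)) / t) \<longlongrightarrow> 0) at_top"
      by real_asymp
    then show ?thesis
      by (intro lim_imp_Limsup) (auto simp: zero_ereal_def)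
  qed
  finally show "growth_rate \<phi> K (1 * \<epsilon>) \<le> 0" .
qed

lemma entropy_on_Un_forward_equicontinuous:
  assumes "is_flow \<phi>" "compact K" "compact L" "forward_equicontinuous_on \<phi> L"
  shows "entropy_on \<phi> (K \<union> L) = entropy_on \<phi> K"
  using entropy_on_Un[OF assms(1-3)] entropy_on_nonneg[OF assms(1,2)]
    entropy_on_forward_equicontinuous[OF assms(1,3,4)] by (simp add: max_absorb1)

lemma forward_equicontinuous_on_subset:
  "forward_equicontinuous_on \<phi> S \<Longrightarrow> T \<subseteq> S \<Longrightarrow> forward_equicontinuous_on \<phi> T"
  unfolding forward_equicontinuous_on_def by (meson subsetD)

lemma entropy_star_eq_0_if_forward_equicontinuous:
  assumes "is_flow \<phi>" "forward_equicontinuous_on \<phi> (- Sing \<phi>)"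
  shows "entropy_star \<phi> = 0"
proof -
  have "entropy_on \<phi> K = 0" if "compact K" "K \<subseteq> - Sing \<phi>" for K
    using assms(1) that(1) forward_equicontinuous_on_subset[OF assms(2) that(2)]
    by (rule entropy_on_forward_equicontinuous)
  then show ?thesis
    unfolding entropy_star_def by (intro SUP_eq_const) auto
qed

lemma forward_equicontinuous_on_Sing: "forward_equicontinuous_on \<phi> (Sing \<phi>)"
  unfolding forward_equicontinuous_on_def Sing_def by (auto intro: less_imp_le)

lemma closed_Sing:
  assumes "is_flow \<phi>"
  shows "closed (Sing \<phi>)"
proof -
  have "continuous_on UNIV (\<phi> t)" for t
    using continuous_on_compose2[of UNIV "\<lambda>p. \<phi> (fst p) (snd p)" UNIV "\<lambda>x. (t, x)"] assms
    by (simp add: is_flow_def continuous_intros)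
  then have "closed {x. \<phi> t x = x}" for t
    by (intro closed_Collect_eq) (auto intro: continuous_intros)
  then have "closed (\<Inter>t. {x. \<phi> t x = x})" by auto
  also have "(\<Inter>t. {x. \<phi> t x = x}) = Sing \<phi>" by (auto simp: Sing_def)
  finally show ?thesis .
qed

lemma forward_equicontinuous_on_Compl_Sing:
  assumes "singular_equicontinuous \<phi>" "closed (Sing \<phi>)"
  shows "forward_equicontinuous_on \<phi> (- Sing \<phi>)"
  unfolding forward_equicontinuous_on_def
proof (intro ballI allI impI)
  fix x and \<epsilon> :: real assume x: "x \<in> - Sing \<phi>" and "\<epsilon> > 0"
  obtain \<delta> where "\<delta> > 0" and close: "\<And>y t. ereal (dist x y) \<le> ereal \<delta> * dist_set x (Sing \<phi>)
      \<Longrightarrow> dist (\<phi> t x) (\<phi> t y) \<le> \<epsilon>"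
    using assms(1) \<open>\<epsilon> > 0\<close> unfolding singular_equicontinuous_def by metis
  define r where "r = (if Sing \<phi> = {} then 1 else \<delta> * infdist x (Sing \<phi>))"
  have "r > 0"
    using \<open>\<delta> > 0\<close> x assms(2) infdist_pos_not_in_closed[of "Sing \<phi>" x] by (simp add: r_def)
  moreover have "ereal (dist x y) \<le> ereal \<delta> * dist_set x (Sing \<phi>)" if "dist x y < r" for y
    using that \<open>\<delta> > 0\<close> by (auto simp: r_def dist_set_def split: if_splits)
  ultimately show "\<exists>r>0. \<forall>y\<in>- Sing \<phi>. dist x y < r \<longrightarrow> (\<forall>t\<ge>0. dist (\<phi> t x) (\<phi> t y) \<le> \<epsilon>)"
    using close by blast
qed

section \<open>Nonwandering points\<close>

definition wandering :: "(real \<Rightarrow> 'a \<Rightarrow> 'a) \<Rightarrow> 'a set \<Rightarrow> bool" where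
  "wandering \<phi> V \<longleftrightarrow> (\<exists>T>0. V \<inter> (\<Union>t\<in>{T..}. \<phi> t ` V) = {})"

definition visits :: "(real \<Rightarrow> 'a \<Rightarrow> 'a) \<Rightarrow> real \<Rightarrow> 'a set \<Rightarrow> 'a \<Rightarrow> nat set" where
  "visits \<phi> \<tau> V z = {j. \<phi> (real j * \<tau>) z \<in> V}"

definition boundedly_visited :: "(real \<Rightarrow> 'a \<Rightarrow> 'a) \<Rightarrow> real \<Rightarrow> 'a set \<Rightarrow> bool" where
  "boundedly_visited \<phi> \<tau> V \<longleftrightarrow> (\<exists>M. \<forall>z. finite (visits \<phi> \<tau> V z) \<and> card (visits \<phi> \<tau> V z) \<le> M)"

lemma not_nonwandering_iff:
  "x \<notin> nonwandering \<phi> \<longleftrightarrow> (\<exists>V. open V \<and> x \<in> V \<and> wandering \<phi> V)"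
  by (simp add: nonwandering_def wandering_def)

lemma closed_nonwandering: "closed (nonwandering \<phi>)"
proof -
  have "\<exists>V. open V \<and> x \<in> V \<and> V \<subseteq> - nonwandering \<phi>" if "x \<notin> nonwandering \<phi>" for x
    using that not_nonwandering_iff[of _ \<phi>] by blast
  then show ?thesis
    unfolding closed_def by (subst open_subopen) auto
qed

lemma Sing_subset_nonwandering: "Sing \<phi> \<subseteq> nonwandering \<phi>"
proof
  fix x assume x: "x \<in> Sing \<phi>"
  have "x \<in> U \<inter> (\<Union>t\<in>{T..}. \<phi> t ` U)" if "x \<in> U" for U T
  proof -
    have "x \<in> \<phi> T ` U"
      using x that by (intro image_eqI[of _ _ x]) (simp_all add: Sing_def)
    then show ?thesis
      using that by auto
  qed
  then show "x \<in> nonwandering \<phi>"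
    by (auto simp: nonwandering_def)
qed

lemma flow_diff:
  assumes "is_flow \<phi>"
  shows "\<phi> (t - s) (\<phi> s x) = \<phi> t x"
proof -
  have "\<phi> (t - s + s) = \<phi> (t - s) \<circ> \<phi> s"
    using assms unfolding is_flow_def by blast
  then show ?thesis by simp
qed

lemma limit_point_nonwandering:
  assumes "is_flow \<phi>" "strict_mono r" "(\<lambda>n. \<phi> (real (r n)) x) \<longlonglongrightarrow> l"
  shows "l \<in> nonwandering \<phi>"
proof -
  have "U \<inter> (\<Union>t\<in>{T..}. \<phi> t ` U) \<noteq> {}" if U: "open U" "l \<in> U" for U T
  proof -
    obtain N where N: "\<And>n. n \<ge> N \<Longrightarrow> \<phi> (real (r n)) x \<in> U"
      using topological_tendstoD[OF assms(3) U] by (auto simp: eventually_sequentially)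
    define m where "m = N + r N + nat \<lceil>T\<rceil>"
    have "m \<le> r m"
      using assms(2) by (rule seq_suble)
    then have "real (r m) - real (r N) \<ge> T"
      unfolding m_def by linarith
    moreover have "\<phi> (real (r m)) x = \<phi> (real (r m) - real (r N)) (\<phi> (real (r N)) x)"
      by (simp add: flow_diff[OF assms(1)])
    moreover have "\<phi> (real (r m)) x \<in> U" "\<phi> (real (r N)) x \<in> U"
      using N by (simp_all add: m_def)
    ultimately have "\<phi> (real (r m)) x \<in> U \<inter> (\<Union>t\<in>{T..}. \<phi> t ` U)"
      by auto
    then show ?thesis by blast
  qed
  then show ?thesis
    by (simp add: nonwandering_def)
qed

lemma nonwandering_nonempty:
  fixes \<phi> :: "real \<Rightarrow> 'a::metric_space \<Rightarrow> 'a"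
  assumes "compact (UNIV :: 'a set)" "is_flow \<phi>"
  shows "nonwandering \<phi> \<noteq> {}"
proof -
  fix x
  have "seq_compact (UNIV :: 'a set)"
    using assms(1) by (simp add: compact_eq_seq_compact_metric)
  then obtain l r where "strict_mono r" "((\<lambda>n. \<phi> (real n) x) \<circ> r) \<longlonglongrightarrow> l"
    by (rule seq_compactE) simp
  then show ?thesis
    using limit_point_nonwandering[OF assms(2)] unfolding o_def by blast
qed

lemma boundedly_visited_subset:
  assumes "boundedly_visited \<phi> \<tau> V" "C \<subseteq> V"
  shows "boundedly_visited \<phi> \<tau> C"
proof -
  have "visits \<phi> \<tau> C z \<subseteq> visits \<phi> \<tau> V z" for z
    using assms(2) by (auto simp: visits_def)
  then show ?thesis
    using assms(1) unfolding boundedly_visited_def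
    by (meson card_mono finite_subset order_trans)
qed

lemma boundedly_visited_Union:
  assumes "finite \<V>" "\<And>V. V \<in> \<V> \<Longrightarrow> boundedly_visited \<phi> \<tau> V"
  shows "boundedly_visited \<phi> \<tau> (\<Union>\<V>)"
proof -
  obtain M where M: "\<And>V z. V \<in> \<V> \<Longrightarrow>
      finite (visits \<phi> \<tau> V z) \<and> card (visits \<phi> \<tau> V z) \<le> M V"
    using assms(2) unfolding boundedly_visited_def by metis
  have visits_Union: "visits \<phi> \<tau> (\<Union>\<V>) z = (\<Union>V\<in>\<V>. visits \<phi> \<tau> V z)" for z
    by (auto simp: visits_def)
  have "card (\<Union>V\<in>\<V>. visits \<phi> \<tau> V z) \<le> (\<Sum>V\<in>\<V>. M V)" for z
    using card_UN_le[OF assms(1), of "\<lambda>V. visits \<phi> \<tau> V z"] M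
    by (meson order_trans sum_mono)
  moreover have "finite (\<Union>V\<in>\<V>. visits \<phi> \<tau> V z)" for z
    using assms(1) M by blast
  ultimately show ?thesis
    unfolding boundedly_visited_def visits_Union by blast
qed

lemma boundedly_visited_wandering:
  assumes "is_flow \<phi>" "\<tau> > 0" "wandering \<phi> V"
  shows "boundedly_visited \<phi> \<tau> V"
proof -
  obtain T where wander: "V \<inter> (\<Union>t\<in>{T..}. \<phi> t ` V) = {}"
    using assms(3) unfolding wandering_def by blast
  obtain n :: nat where n: "T < real n * \<tau>"
    using reals_Archimedean3[OF assms(2)] by blast
  have gap: "j < i + n" if "i \<in> visits \<phi> \<tau> V z" "j \<in> visits \<phi> \<tau> V z" for i j z
  proof (rule ccontr)
    assume "\<not> j < i + n"
    then have "(real i + real n) * \<tau> \<le> real j * \<tau>"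
      using assms(2) by (intro mult_right_mono) auto
    then have "real j * \<tau> - real i * \<tau> \<in> {T..}"
      using n by (simp add: distrib_right)
    moreover have "\<phi> (real j * \<tau>) z = \<phi> (real j * \<tau> - real i * \<tau>) (\<phi> (real i * \<tau>) z)"
      by (simp add: flow_diff[OF assms(1)])
    ultimately have "\<phi> (real j * \<tau>) z \<in> V \<inter> (\<Union>t\<in>{T..}. \<phi> t ` V)"
      using that by (auto simp: visits_def)
    then show False
      using wander by blast
  qed
  have "\<exists>i. visits \<phi> \<tau> V z \<subseteq> {i..<i + n}" for z
  proof (cases "visits \<phi> \<tau> V z = {}")
    case False
    then have "(LEAST i. i \<in> visits \<phi> \<tau> V z) \<in> visits \<phi> \<tau> V z"
      by (auto intro: LeastI)
    then show ?thesis
      using gap by (intro exI[of _ "LEAST i. i \<in> visits \<phi> \<tau> V z"]) (auto intro: Least_le)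
  qed simp
  then have "finite (visits \<phi> \<tau> V z) \<and> card (visits \<phi> \<tau> V z) \<le> n" for z
    using card_mono[of "{_..<_ + n}" "visits \<phi> \<tau> V z"] finite_subset
    by (metis add_diff_cancel_left' card_atLeastLessThan finite_atLeastLessThan)
  then show ?thesis
    unfolding boundedly_visited_def by blast
qed

lemma boundedly_visited_compact:
  assumes "is_flow \<phi>" "\<tau> > 0" "compact C" "C \<inter> nonwandering \<phi> = {}"
  shows "boundedly_visited \<phi> \<tau> C"
proof -
  have "C \<subseteq> \<Union>{V. open V \<and> wandering \<phi> V}"
    using assms(4) not_nonwandering_iff[of _ \<phi>] by blast
  then obtain \<V> where "\<V> \<subseteq> {V. open V \<and> wandering \<phi> V}" "finite \<V>" "C \<subseteq> \<Union>\<V>"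
    by (rule compactE[OF assms(3)]) auto
  then show ?thesis
    using assms(1,2)
    by (blast intro: boundedly_visited_subset boundedly_visited_Union boundedly_visited_wandering)
qed

section \<open>Coding orbits\<close>

definition sparse_words :: "'b set \<Rightarrow> 'b set \<Rightarrow> nat \<Rightarrow> nat \<Rightarrow> 'b list set" where
  "sparse_words G B k M = {xs. length xs = k \<and> set xs \<subseteq> G \<union> B \<and> card {j. j < k \<and> xs ! j \<notin> G} \<le> M}"

definition itinerary :: "(real \<Rightarrow> 'a \<Rightarrow> 'a) \<Rightarrow> real \<Rightarrow> ('a \<Rightarrow> 'b) \<Rightarrow> nat \<Rightarrow> 'a \<Rightarrow> 'b list" where
  "itinerary \<phi> \<tau> letter k z = map (\<lambda>j. letter (\<phi> (real j * \<tau>) z)) [0..<k]"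

lemma sparse_words_0: "sparse_words G B k 0 \<subseteq> {xs. set xs \<subseteq> G \<and> length xs = k}"
  by (auto simp: sparse_words_def in_set_conv_nth)

lemma sparse_words_Suc:
  assumes "G \<noteq> {}"
  shows "sparse_words G B k (Suc M) \<subseteq> sparse_words G B k M
    \<union> (\<lambda>(xs, i, b). xs[i := b]) ` (sparse_words G B k M \<times> {..<k} \<times> B)"
proof
  fix xs assume xs: "xs \<in> sparse_words G B k (Suc M)"
  let ?bad = "\<lambda>ys. {j. j < k \<and> ys ! j \<notin> G}"
  show "xs \<in> sparse_words G B k M
    \<union> (\<lambda>(xs, i, b). xs[i := b]) ` (sparse_words G B k M \<times> {..<k} \<times> B)"
  proof (cases "?bad xs = {}")
    case True
    then have "card (?bad xs) \<le> M"
      by (simp only: card.empty)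
    then show ?thesis
      using xs by (simp add: sparse_words_def)
  next
    case False
    then obtain i g where i: "i < k" "xs ! i \<notin> G" and g: "g \<in> G"
      using assms by blast
    have "xs ! i \<in> set xs"
      using xs i(1) by (simp add: sparse_words_def)
    then have "xs ! i \<in> B"
      using xs i(2) by (auto simp: sparse_words_def)
    have "?bad (xs[i := g]) = ?bad xs - {i}"
      using xs g i(1) by (auto simp: sparse_words_def nth_list_update)
    then have "card (?bad (xs[i := g])) = card (?bad xs) - 1"
      using i by simp
    then have "xs[i := g] \<in> sparse_words G B k M"
      using xs g set_update_subset_insert[of xs i g] by (auto simp: sparse_words_def)
    moreover have "xs = (xs[i := g])[i := xs ! i]"
      by simp
    ultimately show ?thesis
      using i(1) \<open>xs ! i \<in> B\<close> by force
  qed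
qed

lemma card_sparse_words_le:
  assumes "finite G" "finite B" "G \<noteq> {}"
  shows "finite (sparse_words G B k M) \<and> card (sparse_words G B k M) \<le> (1 + card B * k) ^ M * card G ^ k"
proof (induction M)
  case 0
  show ?case
    using finite_lists_length_eq[OF assms(1), of k] card_lists_length_eq[OF assms(1), of k]
      sparse_words_0[of G B k] finite_subset card_mono by fastforce
next
  case (Suc M)
  let ?W = "sparse_words G B k M"
  let ?updated = "(\<lambda>(xs, i, b). xs[i := b]) ` (?W \<times> {..<k} \<times> B)"
  have fin: "finite (?W \<union> ?updated)"
    using Suc.IH assms(2) by blast
  have "card (sparse_words G B k (Suc M)) \<le> card (?W \<union> ?updated)"
    using fin sparse_words_Suc[OF assms(3)] by (rule card_mono)
  also have "\<dots> \<le> card ?W + card ?updated"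
    by (rule card_Un_le)
  also have "card ?updated \<le> card (?W \<times> {..<k} \<times> B)"
    using Suc.IH assms(2) by (intro card_image_le) blast
  also have "card ?W + card (?W \<times> {..<k} \<times> B) = (1 + card B * k) * card ?W"
    by (simp add: card_cartesian_product)
  also have "\<dots> \<le> (1 + card B * k) * ((1 + card B * k) ^ M * card G ^ k)"
    using Suc.IH by (intro mult_le_mono2) blast
  also have "\<dots> = (1 + card B * k) ^ Suc M * card G ^ k"
    by (simp only: power_Suc mult.assoc)
  finally show ?case
    using finite_subset[OF sparse_words_Suc[OF assms(3)] fin] by simp
qed

lemma dyn_ball_if_itinerary_eq:
  assumes "is_flow \<phi>" "\<tau> > 0" "t < real k * \<tau>"
    and close: "\<And>x y. letter x = letter y \<Longrightarrow> y \<in> dyn_ball \<phi> \<tau> \<epsilon> x"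
    and eq: "itinerary \<phi> \<tau> letter k x = itinerary \<phi> \<tau> letter k y"
  shows "y \<in> dyn_ball \<phi> t \<epsilon> x"
proof -
  have "dist (\<phi> s x) (\<phi> s y) \<le> \<epsilon>" if s: "s \<in> {0..t}" for s
  proof -
    define j where "j = nat \<lfloor>s / \<tau>\<rfloor>"
    define u where "u = s - real j * \<tau>"
    have "real j = of_int \<lfloor>s / \<tau>\<rfloor>"
      using s assms(2) by (simp add: j_def)
    then have j: "real j \<le> s / \<tau>" "s / \<tau> < real j + 1"
      by linarith+
    then have "u \<in> {0..\<tau>}"
      using assms(2) by (auto simp: u_def field_simps)
    have "real j * \<tau> \<le> s"
      using j(1) assms(2) by (simp add: field_simps)
    also have "\<dots> < real k * \<tau>"
      using s assms(3) by simp
    finally have "j < k"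
      using assms(2) by simp
    then have "letter (\<phi> (real j * \<tau>) x) = letter (\<phi> (real j * \<tau>) y)"
      using eq by (simp add: itinerary_def)
    then have "dist (\<phi> u (\<phi> (real j * \<tau>) x)) (\<phi> u (\<phi> (real j * \<tau>) y)) \<le> \<epsilon>"
      using close \<open>u \<in> {0..\<tau>}\<close> unfolding dyn_ball_def by blast
    then show ?thesis
      by (simp add: u_def flow_diff[OF assms(1)])
  qed
  then show ?thesis by (simp add: dyn_ball_def)
qed

lemma span_num_le_if_rare_letters:
  assumes "is_flow \<phi>" "\<tau> > 0" "t < real k * \<tau>" "finite G" "finite B" "G \<noteq> {}"
    and letter: "\<And>z. letter z \<in> G \<union> B"
    and close: "\<And>x y. letter x = letter y \<Longrightarrow> y \<in> dyn_ball \<phi> \<tau> \<epsilon> x"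
    and rare: "\<And>z. card {j. j < k \<and> letter (\<phi> (real j * \<tau>) z) \<notin> G} \<le> M"
  shows "span_num \<phi> K t \<epsilon> \<le> (1 + card B * k) ^ M * card G ^ k"
proof -
  have "itinerary \<phi> \<tau> letter k z \<in> sparse_words G B k M" for z
  proof -
    have "{j. j < k \<and> itinerary \<phi> \<tau> letter k z ! j \<notin> G}
        = {j. j < k \<and> letter (\<phi> (real j * \<tau>) z) \<notin> G}"
      by (auto simp: itinerary_def)
    then show ?thesis
      using letter rare by (auto simp: sparse_words_def itinerary_def)
  qed
  then have "span_num \<phi> K t \<epsilon> \<le> card (sparse_words G B k M)"
    using card_sparse_words_le[OF assms(4-6)] dyn_ball_if_itinerary_eq[OF assms(1-3) close]
    by (intro span_num_le_card_coding[where code = "itinerary \<phi> \<tau> letter k"]) auto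
  also have "\<dots> \<le> (1 + card B * k) ^ M * card G ^ k"
    using card_sparse_words_le[OF assms(4-6)] by blast
  finally show ?thesis .
qed

section \<open>Entropy lives on the nonwandering set\<close>

lemma compact_if_closed:
  assumes "compact (UNIV :: 'a::topological_space set)" "closed (S :: 'a set)"
  shows "compact S"
  using compact_Int_closed[OF assms] by simp

lemma ex_centres_of_nonwandering_span:
  fixes \<phi> :: "real \<Rightarrow> 'a::metric_space \<Rightarrow> 'a"
  assumes "compact (UNIV :: 'a set)" "is_flow \<phi>" "\<epsilon> > 0" "spans \<phi> (nonwandering \<phi>) \<tau> \<epsilon> F"
  obtains W C centre where "finite W" "compact C" "C \<inter> nonwandering \<phi> = {}"
    "\<And>z. z \<in> dyn_ball \<phi> \<tau> (2 * \<epsilon>) (centre z)" "\<And>z. centre z \<in> F \<union> W"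
    "\<And>z. centre z \<notin> F \<Longrightarrow> z \<in> C"
proof -
  define U where "U = (\<Union>y\<in>nonwandering \<phi>. interior (dyn_ball \<phi> \<tau> \<epsilon> y))"
  have "closed (- U)"
    by (auto simp: U_def)
  with assms(1) have "compact (- U)"
    by (rule compact_if_closed)
  obtain W where W: "spans \<phi> (- U) \<tau> (2 * \<epsilon>) W"
    using ex_spanning_set[OF assms(2) _ \<open>compact (- U)\<close>, of "2 * \<epsilon>" \<tau>] assms(3) by auto
  have "\<exists>x. z \<in> dyn_ball \<phi> \<tau> (2 * \<epsilon>) x \<and> x \<in> F \<union> W \<and> (x \<notin> F \<longrightarrow> z \<in> - U)" for z
  proof (cases "z \<in> U")
    case True
    then show ?thesis
      using spans_nhd_twice_radius[OF assms(4)] unfolding U_def by blast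
  next
    case False
    then show ?thesis
      using W by (auto simp: spans_def)
  qed
  then obtain centre where centre: "\<And>z. z \<in> dyn_ball \<phi> \<tau> (2 * \<epsilon>) (centre z)"
    "\<And>z. centre z \<in> F \<union> W" "\<And>z. centre z \<notin> F \<Longrightarrow> z \<in> - U"
    by metis
  have "- U \<inter> nonwandering \<phi> = {}"
    using centre_in_interior_dyn_ball[OF assms(2,3)] by (auto simp: U_def)
  moreover have "finite W"
    using W by (simp add: spans_def)
  ultimately show thesis
    using that \<open>compact (- U)\<close> centre by blast
qed

lemma span_num_UNIV_le:
  fixes \<phi> :: "real \<Rightarrow> 'a::metric_space \<Rightarrow> 'a"
  assumes "compact (UNIV :: 'a set)" "is_flow \<phi>" "\<epsilon> > 0" "\<tau> > 0"
  shows "\<exists>b M. \<forall>k t. t < real k * \<tau> \<longrightarrow>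
    span_num \<phi> UNIV t (4 * \<epsilon>) \<le> (1 + b * k) ^ M * span_num \<phi> (nonwandering \<phi>) \<tau> \<epsilon> ^ k"
proof -
  have "compact (nonwandering \<phi>)"
    using assms(1) closed_nonwandering by (rule compact_if_closed)
  then obtain F where F: "spans \<phi> (nonwandering \<phi>) \<tau> \<epsilon> F"
      "card F = span_num \<phi> (nonwandering \<phi>) \<tau> \<epsilon>"
    using ex_minimal_spanning_set[OF assms(2,3)] by metis
  obtain W C centre where W: "finite W" and C: "compact C" "C \<inter> nonwandering \<phi> = {}"
    and near: "\<And>z. z \<in> dyn_ball \<phi> \<tau> (2 * \<epsilon>) (centre z)"
    and centre: "\<And>z. centre z \<in> F \<union> W" "\<And>z. centre z \<notin> F \<Longrightarrow> z \<in> C"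
    using ex_centres_of_nonwandering_span[OF assms(1-3) F(1)] by blast
  obtain M where M: "\<And>z. finite (visits \<phi> \<tau> C z)" "\<And>z. card (visits \<phi> \<tau> C z) \<le> M"
    using boundedly_visited_compact[OF assms(2,4) C] unfolding boundedly_visited_def by metis
  have rare: "card {j. j < k \<and> centre (\<phi> (real j * \<tau>) z) \<notin> F} \<le> M" for k z
  proof -
    have "{j. j < k \<and> centre (\<phi> (real j * \<tau>) z) \<notin> F} \<subseteq> visits \<phi> \<tau> C z"
      using centre(2) by (auto simp: visits_def)
    then show ?thesis
      using card_mono[OF M(1)] M(2) order_trans by blast
  qed
  have close: "y \<in> dyn_ball \<phi> \<tau> (4 * \<epsilon>) x" if "centre x = centre y" for x y
    using dyn_ball_common_centre[OF near[of x], of y] near[of y] that by simp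
  have F_finite: "finite F" "F \<noteq> {}"
    using F(1) nonwandering_nonempty[OF assms(1,2)] by (auto simp: spans_def)
  have "span_num \<phi> UNIV t (4 * \<epsilon>) \<le> (1 + card W * k) ^ M * card F ^ k" if "t < real k * \<tau>" for k t
    using assms(2,4) that F_finite(1) W F_finite(2) centre(1) close rare
    by (rule span_num_le_if_rare_letters)
  then show ?thesis
    unfolding F(2) by blast
qed

lemma Limsup_ln_over_le:
  fixes n :: "real \<Rightarrow> nat"
  assumes "\<tau> > 0" "p > 0"
    and bound: "\<And>k t. t < real k * \<tau> \<Longrightarrow> n t \<le> (1 + b * k) ^ M * p ^ k"
  shows "Limsup at_top (\<lambda>t. ereal (ln (real (n t)) / t)) \<le> ereal (ln (real p) / \<tau>)"
proof -
  define a where "a = real b + 1"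
  have "a > 0" by (simp add: a_def)
  define g where "g t = (real M * ln (1 + a * (t / \<tau> + 1)) + (t / \<tau> + 1) * ln (real p)) / t" for t
  have "ln (real (n t)) / t \<le> g t" if "t > 0" for t
  proof -
    define k where "k = nat \<lfloor>t / \<tau>\<rfloor> + 1"
    have "0 < t / \<tau>"
      using that assms(1) by simp
    then have k: "t / \<tau> < real k" "real k \<le> t / \<tau> + 1"
      unfolding k_def by linarith+
    then have "t < real k * \<tau>"
      using assms(1) by (simp add: field_simps)
    then have "ln (real (n t)) \<le> ln (real ((1 + b * k) ^ M * p ^ k))"
      by (intro ln_of_nat_mono bound)
    also have "\<dots> = real M * ln (1 + real b * real k) + real k * ln (real p)"
      using assms(2) by (simp add: ln_mult ln_realpow add_nonneg_eq_0_iff)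
    also have "\<dots> \<le> real M * ln (1 + a * (t / \<tau> + 1)) + (t / \<tau> + 1) * ln (real p)"
      using k(2) assms(2) by (intro add_mono mult_left_mono mult_right_mono ln_mono mult_mono)
        (auto simp: a_def add_pos_nonneg)
    finally show ?thesis
      using that by (simp add: g_def divide_right_mono)
  qed
  then have "Limsup at_top (\<lambda>t. ereal (ln (real (n t)) / t)) \<le> Limsup at_top (\<lambda>t. ereal (g t))"
    by (intro Limsup_mono eventually_mono[OF eventually_gt_at_top[of 0]]) simp
  also have "\<dots> = ereal (ln (real p) / \<tau>)"
  proof -
    have "(g \<longlongrightarrow> inverse \<tau> * ln (real p)) at_top"
      unfolding g_def using \<open>a > 0\<close> assms(1) by real_asymp
    then show ?thesis
      by (intro lim_imp_Limsup) (auto simp: field_simps)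
  qed
  finally show ?thesis .
qed

lemma growth_rate_UNIV_le:
  fixes \<phi> :: "real \<Rightarrow> 'a::metric_space \<Rightarrow> 'a"
  assumes "compact (UNIV :: 'a set)" "is_flow \<phi>" "\<epsilon> > 0"
  shows "growth_rate \<phi> UNIV (4 * \<epsilon>) \<le> growth_rate \<phi> (nonwandering \<phi>) \<epsilon>"
proof -
  let ?p = "\<lambda>\<tau>. span_num \<phi> (nonwandering \<phi>) \<tau> \<epsilon>"
  have "growth_rate \<phi> UNIV (4 * \<epsilon>) \<le> ereal (ln (real (?p \<tau>)) / \<tau>)" if \<tau>: "\<tau> > 0" for \<tau>
  proof -
    obtain b M where "\<And>k t. t < real k * \<tau> \<Longrightarrow>
        span_num \<phi> UNIV t (4 * \<epsilon>) \<le> (1 + b * k) ^ M * ?p \<tau> ^ k"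
      using span_num_UNIV_le[OF assms \<tau>] by blast
    moreover have "?p \<tau> > 0"
      by (intro span_num_pos assms nonwandering_nonempty compact_if_closed closed_nonwandering)
    ultimately show ?thesis
      unfolding growth_rate_def by (intro Limsup_ln_over_le[OF \<tau>])
  qed
  then show ?thesis
    unfolding growth_rate_def[of \<phi> "nonwandering \<phi>"]
    by (intro le_Limsup eventually_mono[OF eventually_gt_at_top[of 0]]) auto
qed

theorem entropy_eq_entropy_on_nonwandering:
  fixes \<phi> :: "real \<Rightarrow> 'a::metric_space \<Rightarrow> 'a"
  assumes "compact (UNIV :: 'a set)" "is_flow \<phi>"
  shows "entropy \<phi> = entropy_on \<phi> (nonwandering \<phi>)"
proof (rule antisym)
  have compact_nonwandering: "compact (nonwandering \<phi>)"
    using assms(1) closed_nonwandering by (rule compact_if_closed)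
  have "growth_rate \<phi> UNIV (4 * \<epsilon>) \<le> entropy_on \<phi> (nonwandering \<phi>)" if "\<epsilon> > 0" for \<epsilon>
    using growth_rate_UNIV_le[OF assms that]
      growth_rate_le_entropy_on[OF assms(2) compact_nonwandering that] by (rule order_trans)
  then show "entropy \<phi> \<le> entropy_on \<phi> (nonwandering \<phi>)"
    unfolding entropy_def using assms by (intro entropy_on_leI[where c = 4]) auto
  show "entropy_on \<phi> (nonwandering \<phi>) \<le> entropy \<phi>"
    unfolding entropy_def using assms compact_nonwandering by (intro entropy_on_mono) auto
qed

theorem mainTheorem11:
  fixes \<phi> :: "real \<Rightarrow> 'a::metric_space \<Rightarrow> 'a"
  assumes "compact (UNIV :: 'a set)"
    and "is_flow \<phi>"
  shows "(closed (nonwandering \<phi> - Sing \<phi>) \<longrightarrow> entropy_star \<phi> = entropy \<phi>)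
       \<and> (singular_equicontinuous \<phi> \<longrightarrow> entropy_star \<phi> = 0)"
proof (intro conjI impI)
  assume "closed (nonwandering \<phi> - Sing \<phi>)"
  with assms(1) have nonsingular: "compact (nonwandering \<phi> - Sing \<phi>)"
    by (rule compact_if_closed)
  have singular: "compact (Sing \<phi>)"
    using assms(1) closed_Sing[OF assms(2)] by (rule compact_if_closed)
  have "entropy \<phi> = entropy_on \<phi> (nonwandering \<phi>)"
    using assms by (rule entropy_eq_entropy_on_nonwandering)
  also have "nonwandering \<phi> = (nonwandering \<phi> - Sing \<phi>) \<union> Sing \<phi>"
    using Sing_subset_nonwandering by blast
  also have "entropy_on \<phi> \<dots> = entropy_on \<phi> (nonwandering \<phi> - Sing \<phi>)"
    using assms(2) nonsingular singular forward_equicontinuous_on_Sing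
    by (rule entropy_on_Un_forward_equicontinuous)
  also have "\<dots> \<le> entropy_star \<phi>"
    unfolding entropy_star_def using nonsingular by (intro SUP_upper) auto
  finally show "entropy_star \<phi> = entropy \<phi>"
    using entropy_star_le_entropy[OF assms] by (rule antisym[rotated])
next
  assume "singular_equicontinuous \<phi>"
  then have "forward_equicontinuous_on \<phi> (- Sing \<phi>)"
    using closed_Sing[OF assms(2)] by (rule forward_equicontinuous_on_Compl_Sing)
  with assms(2) show "entropy_star \<phi> = 0"
    by (rule entropy_star_eq_0_if_forward_equicontinuous)
qed

end
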